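(* Let $k\ge 1$ be an integer and let $G=(V_1\cup V_2,E)$ be a connected bipartite graph with stable sets $V_1,V_2$, $n=n_1+n_2$ vertices where $n_1=|V_1|$, $n_2=|V_2|$, and diameter $D\ge 2$. Then its $k$-tuple graph $G^{kV_1}$, which has $kn_1+n_2$ vertices, has diameter $D$, and its spectrum consists of the values $\sqrt{k}\,\lambda$ for each eigenvalue $\lambda$ of $G$ (counted with multiplicity), together with the eigenvalue $0$ with additional multiplicity $(k-1)n_1$.
   Context: The $k$-tuple graph $G^{kV_1}$ of a bipartite graph $G$ with stable sets $V_1,V_2$ is obtained by replacing each vertex $u\in V_1$ by $k$ vertices $u_1,\ldots,u_k$, each having the same neighbourhood (in $V_2$) as $u$ had in $G$. The spectrum of a graph is the multiset of eigenvalues of its adjacency matrix. *)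

theory Defs
  imports "Graph_Theory.Graph_Theory" "Jordan_Normal_Form.Char_Poly"
begin

definition stable_set :: "'a pair_pre_digraph \<Rightarrow> 'a set \<Rightarrow> bool" where
  "stable_set G S \<longleftrightarrow> S \<subseteq> pverts G \<and> (\<forall>u\<in>S. \<forall>v\<in>S. (u, v) \<notin> parcs G)"

definition bipartite_graph :: "'a pair_pre_digraph \<Rightarrow> 'a set \<Rightarrow> 'a set \<Rightarrow> bool" where
  "bipartite_graph G V1 V2 \<longleftrightarrow> pair_graph G \<and> pverts G = V1 \<union> V2 \<and> V1 \<inter> V2 = {} \<and>
     stable_set G V1 \<and> stable_set G V2"

text \<open>The copy \<open>u\<^sub>i\<close> of \<open>u \<in> V1\<close> is \<open>Inl (u, i)\<close>; a vertex \<open>w \<in> V2\<close> is kept as \<open>Inr w\<close>.\<close>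

definition ktuple_graph ::
  "nat \<Rightarrow> 'a set \<Rightarrow> 'a set \<Rightarrow> 'a pair_pre_digraph \<Rightarrow> ('a \<times> nat + 'a) pair_pre_digraph" where
  "ktuple_graph k V1 V2 G =
     \<lparr> pverts = Inl ` (V1 \<times> {1..k}) \<union> Inr ` V2,
       parcs = {(Inl (u, i), Inr w) | u i w. u \<in> V1 \<and> i \<in> {1..k} \<and> w \<in> V2 \<and> (u, w) \<in> parcs G} \<union>
               {(Inr w, Inl (u, i)) | u i w. u \<in> V1 \<and> i \<in> {1..k} \<and> w \<in> V2 \<and> (w, u) \<in> parcs G} \<rparr>"

text \<open>With unit arc costs, \<open>\<mu>\<close> is the length of a shortest walk (\<open>\<infinity>\<close> if there is none).\<close>

definition graph_diameter :: "'a pair_pre_digraph \<Rightarrow> ereal" where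
  "graph_diameter G =
     (SUP u\<in>pverts G. SUP v\<in>pverts G. wf_digraph.\<mu> (with_proj G) (\<lambda>_. 1) u v)"

text \<open>The matrix depends on an enumeration \<open>vs\<close> of the vertices. Its entries are complex, so that
  every eigenvalue is a root of the characteristic polynomial in the coefficient field.\<close>

definition adjacency_matrix :: "'a pair_pre_digraph \<Rightarrow> 'a list \<Rightarrow> complex mat" where
  "adjacency_matrix G vs = mat (length vs) (length vs)
     (\<lambda>(i, j). if (vs ! i, vs ! j) \<in> parcs G then 1 else 0)"

definition graph_spectrum :: "'a pair_pre_digraph \<Rightarrow> complex multiset" where
  "graph_spectrum G =
     proots (char_poly (adjacency_matrix G (SOME vs. distinct vs \<and> set vs = pverts G)))"

lemma pair_graph_ktuple_graph:
  assumes "bipartite_graph G V1 V2"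
  shows "pair_graph (ktuple_graph k V1 V2 G)"
proof -
  interpret pair_graph G using assms by (simp add: bipartite_graph_def)
  have fin: "finite V1" "finite V2"
    using assms pair_finite_verts by (auto simp: bipartite_graph_def)
  have sym: "(u, w) \<in> parcs G \<longleftrightarrow> (w, u) \<in> parcs G" for u w
    using pair_sym_arcs by (auto simp: symmetric_def sym_def)
  let ?H = "ktuple_graph k V1 V2 G"
  have finv: "finite (pverts ?H)" using fin by (simp add: ktuple_graph_def)
  have sub: "parcs ?H \<subseteq> pverts ?H \<times> pverts ?H"
    by (auto simp: ktuple_graph_def)
  have fina: "finite (parcs ?H)"
    using finite_subset[OF sub] finv by blast
  show ?thesis
    by unfold_locales
      (use finv fina sub sym in \<open>auto simp: ktuple_graph_def symmetric_def intro!: symI\<close>)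
qed

text \<open>The spectrum does not depend on the chosen enumeration.\<close>

lemma char_poly_adjacency_matrix_cong:
  assumes vs: "distinct vs" and ws: "distinct ws" and eq: "set vs = set ws"
  shows "char_poly (adjacency_matrix G vs) = char_poly (adjacency_matrix G ws)"
proof -
  define n where "n = length vs"
  have n': "length ws = n"
    using distinct_card[OF vs] distinct_card[OF ws] eq by (simp add: n_def)
  define A where "A = adjacency_matrix G vs"
  define B where "B = adjacency_matrix G ws"
  define P :: "complex mat" where "P = mat n n (\<lambda>(i, j). if vs ! i = ws ! j then 1 else 0)"
  define Q :: "complex mat" where "Q = mat n n (\<lambda>(i, j). if ws ! i = vs ! j then 1 else 0)"
  have ex: "\<exists>j<n. ws ! j = vs ! i" if "i < n" for i
    using that eq n' by (metis in_set_conv_nth n_def)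
  then obtain f where f: "\<And>i. i < n \<Longrightarrow> f i < n \<and> ws ! (f i) = vs ! i" by metis
  have ex': "\<exists>j<n. vs ! j = ws ! i" if "i < n" for i
    using that eq n' by (metis in_set_conv_nth n_def)
  then obtain g where g: "\<And>i. i < n \<Longrightarrow> g i < n \<and> vs ! (g i) = ws ! i" by metis
  have fi: "vs ! i = ws ! j \<longleftrightarrow> j = f i" if "i < n" "j < n" for i j
    using f[OF that(1)] that ws n' by (metis nth_eq_iff_index_eq)
  have gi: "ws ! i = vs ! j \<longleftrightarrow> j = g i" if "i < n" "j < n" for i j
    using g[OF that(1)] that vs n_def by (metis nth_eq_iff_index_eq)
  have carr: "A \<in> carrier_mat n n" "B \<in> carrier_mat n n" "P \<in> carrier_mat n n" "Q \<in> carrier_mat n n"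
    by (simp_all add: A_def B_def P_def Q_def adjacency_matrix_def n' flip: n_def)
  have PX: "P * X = mat n n (\<lambda>(i, j). X $$ (f i, j))" if "X \<in> carrier_mat n n" for X
  proof (rule eq_matI)
    fix i j assume "i < dim_row (mat n n (\<lambda>(i, j). X $$ (f i, j)))"
      and "j < dim_col (mat n n (\<lambda>(i, j). X $$ (f i, j)))"
    then have ij: "i < n" "j < n" by auto
    have "(P * X) $$ (i, j) = (\<Sum>l = 0..<n. (if l = f i then X $$ (l, j) else 0))"
      using ij that by (auto simp: P_def scalar_prod_def fi simp del: sum.delta sum.delta' intro!: sum.cong)
    also have "\<dots> = X $$ (f i, j)" using f[OF ij(1)] by simp
    finally show "(P * X) $$ (i, j) = mat n n (\<lambda>(i, j). X $$ (f i, j)) $$ (i, j)"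
      using ij by simp
  qed (use that in \<open>auto simp: P_def\<close>)
  have QX: "Q * X = mat n n (\<lambda>(i, j). X $$ (g i, j))" if "X \<in> carrier_mat n n" for X
  proof (rule eq_matI)
    fix i j assume "i < dim_row (mat n n (\<lambda>(i, j). X $$ (g i, j)))"
      and "j < dim_col (mat n n (\<lambda>(i, j). X $$ (g i, j)))"
    then have ij: "i < n" "j < n" by auto
    have "(Q * X) $$ (i, j) = (\<Sum>l = 0..<n. (if l = g i then X $$ (l, j) else 0))"
      using ij that by (auto simp: Q_def scalar_prod_def gi simp del: sum.delta sum.delta' intro!: sum.cong)
    also have "\<dots> = X $$ (g i, j)" using g[OF ij(1)] by simp
    finally show "(Q * X) $$ (i, j) = mat n n (\<lambda>(i, j). X $$ (g i, j)) $$ (i, j)"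
      using ij by simp
  qed (use that in \<open>auto simp: Q_def\<close>)
  have PQ: "P * Q = 1\<^sub>m n"
    unfolding PX[OF carr(4)] 
    by (rule eq_matI) (use f vs n_def in \<open>auto simp: Q_def nth_eq_iff_index_eq\<close>)
  have QP: "Q * P = 1\<^sub>m n"
    unfolding QX[OF carr(3)]
    by (rule eq_matI) (use g ws n' in \<open>auto simp: P_def nth_eq_iff_index_eq\<close>)
  have "A * P = P * B"
  proof (rule eq_matI)
    fix i j assume "i < dim_row (P * B)" and "j < dim_col (P * B)"
    then have ij: "i < n" "j < n" using carr by auto
    have "(A * P) $$ (i, j) = (\<Sum>l = 0..<n. (if l = g j then A $$ (i, l) else 0))"
      using ij carr by (auto simp: P_def scalar_prod_def gi[OF ij(2)] eq_commute[of "vs ! _" "ws ! j"]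
          simp del: sum.delta sum.delta' intro!: sum.cong)
    also have "\<dots> = A $$ (i, g j)" using g[OF ij(2)] by simp
    also have "\<dots> = B $$ (f i, j)"
      using f[OF ij(1)] g[OF ij(2)] ij n' n_def by (simp add: A_def B_def adjacency_matrix_def)
    finally show "(A * P) $$ (i, j) = (P * B) $$ (i, j)"
      using ij by (simp add: PX[OF carr(2)])
  qed (use carr in auto)
  then have "A = P * B * Q"
    using carr PQ by (metis assoc_mult_mat right_mult_one_mat)
  then have "similar_mat A B"
    using carr by (intro similar_matI[OF _ PQ QP]) blast+
  then show ?thesis unfolding A_def B_def by (rule char_poly_similar)
qed

lemma graph_spectrum_eq:
  assumes "distinct vs" and "set vs = pverts G"
  shows "graph_spectrum G = proots (char_poly (adjacency_matrix G vs))"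
proof -
  have "distinct (SOME vs. distinct vs \<and> set vs = pverts G) \<and>
        set (SOME vs. distinct vs \<and> set vs = pverts G) = pverts G"
    by (rule someI[of _ vs]) (use assms in simp)
  then show ?thesis
    unfolding graph_spectrum_def using assms
    by (metis char_poly_adjacency_matrix_cong)
qed

end

theory Submission
  imports Defs
begin

text \<open>
  Ordering the vertices by stable set, the adjacency matrix of a bipartite graph is
  \<open>M = [[0, B], [C, 0]]\<close> with \<open>B\<close> of size \<open>m \<times> n\<close>, and multiplying \<open>x I - M\<close> by
  \<open>[[I, B], [0, x I]]\<close> gives \<open>x\<^sup>n \<chi>\<^sub>M(x) = x\<^sup>m \<chi>\<^sub>C\<^sub>B(x\<^sup>2)\<close>. Entries of \<open>C B\<close> count common
  neighbours in the first stable set, so the \<open>k\<close>-tuple graph replaces \<open>C B\<close> by \<open>k C B\<close> and \<open>m\<close> by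
  \<open>k m\<close>; comparing the two identities scales the spectrum by \<open>sqrt k\<close> and adds \<open>(k - 1) m\<close> zeros.

  For the diameter, the projection of the \<open>k\<close>-tuple graph onto the graph preserves and reflects arcs,
  so every walk projects and every nonempty walk lifts, with prescribed end points, to one of the
  same length. Two copies of one vertex are at distance 2, which the hypothesis on the diameter allows.
\<close>

section \<open>Characteristic polynomials and multisets of roots\<close>

text \<open>Powers of \<open>x\<close> stand on both sides because either of \<open>m\<close> and
  \<open>n\<close> may be the larger; in this form the identity also holds at
  \<open>x = 0\<close>.\<close>

lemma char_poly_antidiagonal_blocks:
  fixes B C :: "'a :: field mat"
  assumes B: "B \<in> carrier_mat m n" and C: "C \<in> carrier_mat n m"
  shows "x ^ n * poly (char_poly (four_block_mat (0\<^sub>m m m) B C (0\<^sub>m n n))) x =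
    x ^ m * poly (char_poly (C * B)) (x ^ 2)"
proof -
  let ?M = "four_block_mat (0\<^sub>m m m) B C (0\<^sub>m n n)"
  have M: "?M \<in> carrier_mat (m + n) (m + n)" by (rule four_block_carrier_mat) auto
  have CB: "C * B \<in> carrier_mat n n" using B C by simp
  \<comment> \<open>\<open>?L\<close> is \<open>x I - M\<close>. The block column
    \<open>(B, x I)\<close> of \<open>?U\<close> cancels the upper right block of the product, while
    \<open>det ?U = x ^ n\<close>.\<close>
  let ?L = "four_block_mat (x \<cdot>\<^sub>m 1\<^sub>m m) (- B) (- C) (x \<cdot>\<^sub>m 1\<^sub>m n)"
  let ?U = "four_block_mat (1\<^sub>m m) B (0\<^sub>m n m) (x \<cdot>\<^sub>m 1\<^sub>m n)"
  have L: "?L \<in> carrier_mat (m + n) (m + n)" and U: "?U \<in> carrier_mat (m + n) (m + n)"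
    by (rule four_block_carrier_mat; simp)+
  have eqL: "- char_matrix ?M x = ?L"
    using B C by (intro eq_matI) (auto simp: char_matrix_def)
  have eqR: "- char_matrix (C * B) (x ^ 2) = - (C * B) + (x ^ 2) \<cdot>\<^sub>m 1\<^sub>m n"
    using B C by (intro eq_matI) (auto simp: char_matrix_def)
  have mul: "?L * ?U = four_block_mat (x \<cdot>\<^sub>m 1\<^sub>m m) (0\<^sub>m m n) (- C) (- (C * B) + (x ^ 2) \<cdot>\<^sub>m 1\<^sub>m n)"
  proof (subst mult_four_block_mat[of _ m m _ n _ n _ _ m _ n])
    show "four_block_mat (x \<cdot>\<^sub>m 1\<^sub>m m * 1\<^sub>m m + - B * 0\<^sub>m n m)
      (x \<cdot>\<^sub>m 1\<^sub>m m * B + - B * (x \<cdot>\<^sub>m 1\<^sub>m n)) (- C * 1\<^sub>m m + x \<cdot>\<^sub>m 1\<^sub>m n * 0\<^sub>m n m)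
      (- C * B + x \<cdot>\<^sub>m 1\<^sub>m n * (x \<cdot>\<^sub>m 1\<^sub>m n)) =
      four_block_mat (x \<cdot>\<^sub>m 1\<^sub>m m) (0\<^sub>m m n) (- C) (- (C * B) + (x ^ 2) \<cdot>\<^sub>m 1\<^sub>m n)"
    proof (intro arg_cong4[of _ _ _ _ _ _ _ _ four_block_mat])
      have "x \<cdot>\<^sub>m 1\<^sub>m m * B = x \<cdot>\<^sub>m B"
        using B by (simp add: mult_smult_assoc_mat[OF one_carrier_mat B])
      moreover have "- B * (x \<cdot>\<^sub>m 1\<^sub>m n) = x \<cdot>\<^sub>m - B"
        using B by (simp add: mult_smult_distrib[of _ m n _ n])
      ultimately show "x \<cdot>\<^sub>m 1\<^sub>m m * B + - B * (x \<cdot>\<^sub>m 1\<^sub>m n) = 0\<^sub>m m n"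
        using B by (intro eq_matI) auto
      have "- C * B = - (C * B)" using B C by simp
      moreover have "x \<cdot>\<^sub>m 1\<^sub>m n * (x \<cdot>\<^sub>m 1\<^sub>m n) = (x ^ 2) \<cdot>\<^sub>m 1\<^sub>m n"
        by (intro eq_matI) (auto simp: mult_smult_distrib[of _ n n _ n] power2_eq_square)
      ultimately show "- C * B + x \<cdot>\<^sub>m 1\<^sub>m n * (x \<cdot>\<^sub>m 1\<^sub>m n) = - (C * B) + (x ^ 2) \<cdot>\<^sub>m 1\<^sub>m n"
        by simp
    qed (use B C in auto)
  qed (use B C in auto)
  have "x ^ n * poly (char_poly ?M) x = det ?L * det ?U"
    unfolding char_poly_matrix[OF M] eqL
    by (subst det_four_block_mat_lower_left_zero[of "1\<^sub>m m" m B n]) (use B in auto)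
  also have "\<dots> = det (?L * ?U)" by (rule det_mult[OF L U, symmetric])
  also have "\<dots> = x ^ m * det (- (C * B) + (x ^ 2) \<cdot>\<^sub>m 1\<^sub>m n)"
    unfolding mul by (subst det_four_block_mat_upper_right_zero[of _ m _ n]) (use B C in auto)
  finally show ?thesis unfolding char_poly_matrix[OF CB] eqR .
qed

lemma poly_char_poly_smult_mat:
  fixes A :: "'a :: field mat"
  assumes A: "A \<in> carrier_mat n n"
  shows "poly (char_poly (c \<cdot>\<^sub>m A)) (c * x) = c ^ n * poly (char_poly A) x"
proof -
  have cA: "c \<cdot>\<^sub>m A \<in> carrier_mat n n" using A by simp
  have "- char_matrix (c \<cdot>\<^sub>m A) (c * x) = c \<cdot>\<^sub>m (- char_matrix A x)"
    using A by (intro eq_matI) (auto simp: char_matrix_def algebra_simps)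
  then show ?thesis
    unfolding char_poly_matrix[OF A] char_poly_matrix[OF cA] using A by (simp add: char_matrix_def)
qed

text \<open>Over the complex numbers \<open>p\<close> splits into linear factors, so scaling each
  root by \<open>s\<close> and adjoining \<open>r\<close> zeros determines \<open>q\<close> up to a
  constant. Only nonzero \<open>x\<close> are assumed, since the equation will come from cancelling
  a power of \<open>x\<close>.\<close>

lemma proots_scaled:
  fixes p q :: "complex poly"
  assumes "s \<noteq> 0" "c \<noteq> 0" "p \<noteq> 0"
    and eq: "\<And>x. x \<noteq> 0 \<Longrightarrow> poly q (s * x) = c * x ^ r * poly p x"
  shows "proots q = image_mset ((*) s) (proots p) + replicate_mset r 0"
proof -
  define F where "F = (\<lambda>M. \<Prod>a\<in>#M. [:- (s * a), 1:])"
  have poly_F: "poly (F M) (s * x) = s ^ size M * poly (\<Prod>a\<in>#M. [:- a, 1:]) x" for M x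
    by (induction M) (simp_all add: F_def algebra_simps)
  have F: "F M \<noteq> 0 \<and> proots (F M) = image_mset ((*) s) M" for M
    by (induction M) (auto simp: F_def proots_mult simp del: mult_pCons_left)
  \<comment> \<open>The substitution \<open>s * x\<close> draws one factor \<open>s\<close> from
    each root of \<open>p\<close> and from each of the \<open>r\<close> zeros; \<open>d\<close>
    compensates for these.\<close>
  define d where "d = c * lead_coeff p / s ^ (size (proots p) + r)"
  have "d \<noteq> 0" using assms by (simp add: d_def)
  \<comment> \<open>The extra factor \<open>[:0, 1:]\<close> makes both sides vanish at 0, the point
    where the assumption says nothing; it is cancelled afterwards.\<close>
  have "[:0, 1:] * q = [:0, 1:] * Polynomial.smult d ([:0, 1:] ^ r * F (proots p))"
  proof (rule poly_eq_poly_eq_iff[THEN iffD1], rule ext)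
    fix y
    show "poly ([:0, 1:] * q) y = poly ([:0, 1:] * Polynomial.smult d ([:0, 1:] ^ r * F (proots p))) y"
    proof (cases "y = 0")
      case False
      define x where "x = y / s"
      have x: "y = s * x" "x \<noteq> 0" using False assms by (simp_all add: x_def)
      have "poly p x = lead_coeff p * poly (\<Prod>a\<in>#proots p. [:- a, 1:]) x"
        using complex_poly_decompose_multiset[of p] by (metis poly_smult)
      then show ?thesis
        using assms(1) x(2) by (simp add: x(1) eq poly_F d_def power_add power_mult_distrib)
    qed simp
  qed
  then have "q = Polynomial.smult d ([:0, 1:] ^ r * F (proots p))" by simp
  then show ?thesis using \<open>d \<noteq> 0\<close> F by (simp add: proots_mult proots_power)
qed

section \<open>Walks and diameter under a projection that preserves and reflects arcs\<close>

lemma (in wf_digraph) awalk_cost_one: "awalk_cost (\<lambda>_. 1) p = real (length p)"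
  by (induction p) auto

lemma \<mu>_le_graph_diameter:
  assumes "u \<in> pverts G" "v \<in> pverts G"
  shows "wf_digraph.\<mu> (with_proj G) (\<lambda>_. 1) u v \<le> graph_diameter G"
  unfolding graph_diameter_def by (rule SUP_upper2[OF assms(1)], rule SUP_upper[OF assms(2)])

lemma awalk_image:
  assumes G: "pair_wf_digraph G" and H: "pair_wf_digraph H"
    and verts: "\<pi> ` pverts H \<subseteq> pverts G"
    and arcs: "\<And>x y. (x, y) \<in> parcs H \<Longrightarrow> (\<pi> x, \<pi> y) \<in> parcs G"
    and q: "pre_digraph.awalk (with_proj H) x q y"
  shows "pre_digraph.awalk (with_proj G) (\<pi> x) (map (map_prod \<pi> \<pi>) q) (\<pi> y)"
proof -
  interpret G: pair_wf_digraph G by fact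
  interpret H: pair_wf_digraph H by fact
  show ?thesis using q verts arcs
    by (induction q arbitrary: x) (auto simp: H.awalk_simps G.awalk_simps)
qed

text \<open>Since arcs are reflected, inner vertices may be replaced by arbitrary preimages. The
  walk must be nonempty: an empty walk lifts only if \<open>x = y\<close>, which does not follow
  from equal images.\<close>

lemma awalk_lift:
  assumes G: "pair_wf_digraph G" and H: "pair_wf_digraph H"
    and surj: "\<pi> ` pverts H = pverts G"
    and arcs: "\<And>x y. x \<in> pverts H \<Longrightarrow> y \<in> pverts H \<Longrightarrow> (\<pi> x, \<pi> y) \<in> parcs G \<Longrightarrow> (x, y) \<in> parcs H"
    and p: "pre_digraph.awalk (with_proj G) (\<pi> x) p (\<pi> y)" "p \<noteq> []"
    and xy: "x \<in> pverts H" "y \<in> pverts H"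
  shows "\<exists>q. pre_digraph.awalk (with_proj H) x q y \<and> length q = length p"
proof -
  interpret G: pair_wf_digraph G by fact
  interpret H: pair_wf_digraph H by fact
  show ?thesis using p xy(1)
  proof (induction p arbitrary: x)
    case (Cons e p)
    obtain a m where e: "e = (a, m)" by force
    have a: "a = \<pi> x" "(\<pi> x, m) \<in> parcs G" and p: "G.awalk m p (\<pi> y)"
      using Cons.prems e by (auto simp: G.awalk_simps)
    show ?case
    proof (cases "p = []")
      \<comment> \<open>The last arc must end in the prescribed \<open>y\<close>, not in just any
        preimage of \<open>m\<close>, so the induction starts at length 1.\<close>
      case True
      then have "m = \<pi> y" using p by (simp add: G.awalk_simps)
      then have "(x, y) \<in> parcs H" using a arcs Cons.prems xy by auto
      then have "H.awalk x [(x, y)] y" using xy by (simp add: H.awalk_simps)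
      then show ?thesis using True by (intro exI[of _ "[(x, y)]"]) simp
    next
      case False
      obtain z where z: "z \<in> pverts H" "m = \<pi> z"
        using surj a(2) G.in_arcsD2 by (metis imageE)
      obtain q where "H.awalk z q y" "length q = length p"
        using Cons.IH[of z] p False z by auto
      moreover have "(x, z) \<in> parcs H" using arcs a z Cons.prems by auto
      ultimately show ?thesis
        using Cons.prems by (intro exI[of _ "(x, z) # q"]) (simp add: H.awalk_simps)
    qed
  qed simp
qed

text \<open>Lifting bounds distances between vertices with different images, and a detour of length
  2 handles equal images; projecting walks gives the converse bound.\<close>

lemma graph_diameter_blow_up:
  assumes G: "pair_graph G" and H: "pair_wf_digraph H"
    and surj: "\<pi> ` pverts H = pverts G"
    and arcs: "\<And>x y. x \<in> pverts H \<Longrightarrow> y \<in> pverts H \<Longrightarrow> (x, y) \<in> parcs H \<longleftrightarrow> (\<pi> x, \<pi> y) \<in> parcs G"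
    and fin: "graph_diameter G < \<infinity>" and ge: "2 \<le> graph_diameter G"
  shows "graph_diameter H = graph_diameter G"
proof (rule antisym)
  interpret G: pair_graph G by fact
  interpret H: pair_wf_digraph H by fact
  have lt: "G.\<mu> (\<lambda>_. 1) u v < \<infinity>" if "u \<in> pverts G" "v \<in> pverts G" for u v
    using \<mu>_le_graph_diameter[OF that] fin by (meson le_less_trans)
  \<comment> \<open>Diameter at least 2 forces a second vertex, finite distance gives a walk to it,
    and the first arc of that walk leads to a neighbour.\<close>
  have nbr: "\<exists>z. (u, z) \<in> parcs G" if u: "u \<in> pverts G" for u
  proof -
    have "\<exists>v \<in> pverts G. v \<noteq> u"
    proof (rule ccontr)
      assume "\<not> ?thesis"
      then have "pverts G = {u}" using u by blast
      moreover have "G.awalk u [] u" using u by (simp add: G.awalk_Nil_iff)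
      from G.min_cost_le_walk_cost[OF this] have "G.\<mu> (\<lambda>_. 1) u u \<le> 0"
        unfolding G.awalk_cost_Nil by (simp only: zero_ereal_def)
      ultimately have "graph_diameter G \<le> 0" by (simp only: graph_diameter_def) simp
      with ge have "(2 :: ereal) \<le> 0" by (rule order_trans)
      then show False by simp
    qed
    then obtain v where v: "v \<in> pverts G" "v \<noteq> u" by blast
    then have "u \<rightarrow>\<^sup>*\<^bsub>with_proj G\<^esub> v" using lt[OF u] by (simp only: G.\<mu>_reach_conv)
    then obtain p where "G.awalk u p v" by (auto simp only: G.reachable_awalk)
    then show ?thesis using v by (cases p) (auto simp: G.awalk_simps)
  qed
  show "graph_diameter H \<le> graph_diameter G"
    unfolding graph_diameter_def[of H]
  proof (intro SUP_least)
    fix x y assume xy: "x \<in> pverts H" "y \<in> pverts H"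
    have bound: "H.\<mu> (\<lambda>_. 1) x y \<le> ereal (real (length p))"
      if walk: "G.awalk (\<pi> x) p (\<pi> y)" "p \<noteq> []" for p
    proof -
      obtain q where "H.awalk x q y" "length q = length p"
        using awalk_lift[of G H \<pi> x p y, OF G.pair_wf_digraph_axioms H surj arcs[THEN iffD2] walk xy]
        by blast
      then show ?thesis using H.min_cost_le_walk_cost[of x q y "\<lambda>_. 1"] by (simp add: H.awalk_cost_one)
    qed
    have \<pi>xy: "\<pi> x \<in> pverts G" "\<pi> y \<in> pverts G" using xy surj by auto
    show "H.\<mu> (\<lambda>_. 1) x y \<le> graph_diameter G"
    proof (cases "\<pi> x = \<pi> y")
      \<comment> \<open>Going to a neighbour and back is a nonempty closed walk, so it lifts to join
        any two preimages of \<open>\<pi> x\<close>.\<close>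
      case True
      obtain z where "(\<pi> x, z) \<in> parcs G" using nbr \<pi>xy by blast
      moreover from this have "(z, \<pi> x) \<in> parcs G"
        using G.pair_sym_arcs by (auto simp: symmetric_def sym_def)
      ultimately have "G.awalk (\<pi> x) [(\<pi> x, z), (z, \<pi> x)] (\<pi> y)"
        using True \<pi>xy by (simp add: G.awalk_simps)
      from bound[OF this] have "H.\<mu> (\<lambda>_. 1) x y \<le> 2" by simp
      then show ?thesis using ge by (rule order_trans)
    next
      case False
      have "H.\<mu> (\<lambda>_. 1) x y \<le> G.\<mu> (\<lambda>_. 1) (\<pi> x) (\<pi> y)"
        unfolding G.\<mu>_def
      proof (rule INF_greatest)
        fix p assume "p \<in> {p. G.awalk (\<pi> x) p (\<pi> y)}"
        then show "H.\<mu> (\<lambda>_. 1) x y \<le> ereal (G.awalk_cost (\<lambda>_. 1) p)"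
          using bound[of p] False by (cases "p = []") (auto simp: G.awalk_cost_one G.awalk_simps)
      qed
      then show ?thesis using \<mu>_le_graph_diameter[OF \<pi>xy] by (rule order_trans)
    qed
  qed
  show "graph_diameter G \<le> graph_diameter H"
    unfolding graph_diameter_def[of G]
  proof (intro SUP_least)
    fix u v assume "u \<in> pverts G" "v \<in> pverts G"
    then obtain x y where xy: "x \<in> pverts H" "y \<in> pverts H" and uv: "u = \<pi> x" "v = \<pi> y"
      using surj by blast
    have arcs': "(\<pi> x, \<pi> y) \<in> parcs G" if "(x, y) \<in> parcs H" for x y
      using that arcs H.in_arcsD1 H.in_arcsD2 by blast
    \<comment> \<open>Projection keeps the length of a walk, so any choice of preimages of
      \<open>u\<close> and \<open>v\<close> serves.\<close>
    have "G.\<mu> (\<lambda>_. 1) u v \<le> H.\<mu> (\<lambda>_. 1) x y"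
      unfolding H.\<mu>_def
    proof (rule INF_greatest)
      fix q assume "q \<in> {q. H.awalk x q y}"
      then have "G.awalk u (map (map_prod \<pi> \<pi>) q) v"
        using awalk_image[OF G.pair_wf_digraph_axioms H, of \<pi> x q y] surj arcs' uv by auto
      from G.min_cost_le_walk_cost[OF this, of "\<lambda>_. 1"]
      show "G.\<mu> (\<lambda>_. 1) u v \<le> ereal (H.awalk_cost (\<lambda>_. 1) q)"
        by (simp add: G.awalk_cost_one H.awalk_cost_one)
    qed
    then show "G.\<mu> (\<lambda>_. 1) u v \<le> graph_diameter H"
      using \<mu>_le_graph_diameter[OF xy] by (rule order_trans)
  qed
qed

section \<open>Spectra of bipartite graphs and of their k-tuple graphs\<close>

text \<open>Used with the two lists in either order, it supplies both off-diagonal blocks without a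
  transpose.\<close>

definition biadjacency_matrix :: "'a pair_pre_digraph \<Rightarrow> 'a list \<Rightarrow> 'a list \<Rightarrow> complex mat" where
  "biadjacency_matrix G us ws = mat (length us) (length ws)
     (\<lambda>(i, j). if (us ! i, ws ! j) \<in> parcs G then 1 else 0)"

text \<open>This is the product \<open>C B\<close> of the overview. Taking \<open>A\<close> as a set
  makes it independent of how the first stable set is enumerated.\<close>

definition codegree_matrix :: "'a pair_pre_digraph \<Rightarrow> 'a set \<Rightarrow> 'a list \<Rightarrow> complex mat" where
  "codegree_matrix G A ws = mat (length ws) (length ws)
     (\<lambda>(i, j). of_nat (card {u \<in> A. (ws ! i, u) \<in> parcs G \<and> (u, ws ! j) \<in> parcs G}))"

lemma codegree_matrix_carrier [simp]:
  "codegree_matrix G A ws \<in> carrier_mat (length ws) (length ws)"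
  by (simp add: codegree_matrix_def)

lemma adjacency_matrix_bipartite:
  assumes "bipartite_graph G (set us) (set ws)"
  shows "adjacency_matrix G (us @ ws) =
    four_block_mat (0\<^sub>m (length us) (length us)) (biadjacency_matrix G us ws)
      (biadjacency_matrix G ws us) (0\<^sub>m (length ws) (length ws))"
  using assms
  by (intro eq_matI)
    (auto simp: adjacency_matrix_def biadjacency_matrix_def bipartite_graph_def stable_set_def nth_append)

lemma biadjacency_matrix_mult:
  assumes "distinct us"
  shows "biadjacency_matrix G ws us * biadjacency_matrix G us ws = codegree_matrix G (set us) ws"
proof (rule eq_matI)
  fix i j assume "i < dim_row (codegree_matrix G (set us) ws)" "j < dim_col (codegree_matrix G (set us) ws)"
  then have ij: "i < length ws" "j < length ws" by (auto simp: codegree_matrix_def)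
  let ?P = "\<lambda>u. (ws ! i, u) \<in> parcs G \<and> (u, ws ! j) \<in> parcs G"
  have "(biadjacency_matrix G ws us * biadjacency_matrix G us ws) $$ (i, j) =
      (\<Sum>l = 0..<length us. if ?P (us ! l) then 1 else 0)"
    using ij by (auto simp: biadjacency_matrix_def scalar_prod_def intro!: sum.cong)
  also have "\<dots> = (\<Sum>u\<in>set us. if ?P u then 1 else 0)"
    by (rule sum.reindex_bij_betw)
      (use bij_betw_nth[OF assms, of "{..<length us}" "set us"] in \<open>simp add: atLeast0LessThan\<close>)
  also have "\<dots> = of_nat (card {u \<in> set us. ?P u})"
    by (simp flip: sum.inter_filter)
  finally show "(biadjacency_matrix G ws us * biadjacency_matrix G us ws) $$ (i, j) =
      codegree_matrix G (set us) ws $$ (i, j)"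
    using ij by (simp add: codegree_matrix_def)
qed (simp_all add: biadjacency_matrix_def codegree_matrix_def)

lemma char_poly_adjacency_matrix_bipartite:
  assumes "bipartite_graph G (set us) (set ws)" "distinct us"
  shows "x ^ length ws * poly (char_poly (adjacency_matrix G (us @ ws))) x =
    x ^ length us * poly (char_poly (codegree_matrix G (set us) ws)) (x ^ 2)"
  unfolding adjacency_matrix_bipartite[OF assms(1)] biadjacency_matrix_mult[OF assms(2), symmetric]
  by (rule char_poly_antidiagonal_blocks) (simp_all add: biadjacency_matrix_def)

lemma bipartite_ktuple_graph:
  assumes "bipartite_graph G V1 V2"
  shows "bipartite_graph (ktuple_graph k V1 V2 G) (Inl ` (V1 \<times> {1..k})) (Inr ` V2)"
  using pair_graph_ktuple_graph[OF assms, of k]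
  by (auto simp: bipartite_graph_def stable_set_def ktuple_graph_def)

text \<open>The common neighbours of two vertices of \<open>V2\<close> are exactly the
  \<open>k\<close> copies of each of their former common neighbours.\<close>

lemma codegree_matrix_ktuple_graph:
  assumes "set ws = V2"
  shows "codegree_matrix (ktuple_graph k V1 V2 G) (Inl ` (V1 \<times> {1..k})) (map Inr ws) =
    of_nat k \<cdot>\<^sub>m codegree_matrix G V1 ws"
proof (rule eq_matI)
  fix i j assume "i < dim_row (of_nat k \<cdot>\<^sub>m codegree_matrix G V1 ws)"
    and "j < dim_col (of_nat k \<cdot>\<^sub>m codegree_matrix G V1 ws)"
  then have ij: "i < length ws" "j < length ws" by (auto simp: codegree_matrix_def)
  then have "ws ! i \<in> V2" "ws ! j \<in> V2" using assms by auto
  then have "{x \<in> Inl ` (V1 \<times> {1..k}). (Inr (ws ! i), x) \<in> parcs (ktuple_graph k V1 V2 G) \<and>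
        (x, Inr (ws ! j)) \<in> parcs (ktuple_graph k V1 V2 G)} =
      Inl ` ({u \<in> V1. (ws ! i, u) \<in> parcs G \<and> (u, ws ! j) \<in> parcs G} \<times> {1..k})"
    by (auto simp: ktuple_graph_def)
  then show "codegree_matrix (ktuple_graph k V1 V2 G) (Inl ` (V1 \<times> {1..k})) (map Inr ws) $$ (i, j) =
      (of_nat k \<cdot>\<^sub>m codegree_matrix G V1 ws) $$ (i, j)"
    using ij by (simp add: codegree_matrix_def card_image card_cartesian_product)
qed (simp_all add: codegree_matrix_def)

lemma graph_spectrum_ktuple_graph:
  assumes k: "k \<ge> 1" and bip: "bipartite_graph G V1 V2"
  shows "graph_spectrum (ktuple_graph k V1 V2 G) =
      image_mset (\<lambda>x. complex_of_real (sqrt (real k)) * x) (graph_spectrum G) +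
      replicate_mset ((k - 1) * card V1) 0"
proof -
  let ?H = "ktuple_graph k V1 V2 G"
  interpret pair_graph G using bip by (simp add: bipartite_graph_def)
  have V: "pverts G = V1 \<union> V2" "V1 \<inter> V2 = {}" using bip by (auto simp: bipartite_graph_def)
  then have fin: "finite V1" "finite V2" using pair_finite_verts by auto
  obtain us where us: "distinct us" "set us = V1" using finite_distinct_list[OF fin(1)] by blast
  obtain ws where ws: "distinct ws" "set ws = V2" using finite_distinct_list[OF fin(2)] by blast
  have "finite (Inl ` (V1 \<times> {1..k}) :: ('a \<times> nat + 'a) set)" using fin by simp
  then obtain us' :: "('a \<times> nat + 'a) list"
    where us': "distinct us'" "set us' = Inl ` (V1 \<times> {1..k})"
    using finite_distinct_list by blast
  \<comment> \<open>The copies in \<open>us'\<close> may come in any order, but \<open>ws'\<close>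
    follows \<open>ws\<close> so that the two codegree matrices compare entry by entry.\<close>
  define ws' :: "('a \<times> nat + 'a) list" where "ws' = map Inr ws"
  have ws': "distinct ws'" "set ws' = Inr ` V2" "length ws' = length ws"
    using ws by (auto simp: ws'_def distinct_map)
  define m n where "m = length us" and "n = length ws"
  have m: "card V1 = m" using us distinct_card by (fastforce simp: m_def)
  have "length us' = card (Inl ` (V1 \<times> {1..k}) :: ('a \<times> nat + 'a) set)"
    using us' distinct_card by fastforce
  also have "\<dots> = k * m" by (simp add: card_image card_cartesian_product m)
  finally have len': "length us' = k * m" .
  define p q c where "p = char_poly (adjacency_matrix G (us @ ws))"
    and "q = char_poly (adjacency_matrix ?H (us' @ ws'))"
    and "c = char_poly (codegree_matrix G V1 ws)"
  define s where "s = complex_of_real (sqrt (real k))"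
  have s2: "s ^ 2 = of_nat k" unfolding s_def by (simp flip: of_real_power)
  have s0: "s \<noteq> 0" using k by (simp add: s_def)
  have p: "x ^ n * poly p x = x ^ m * poly c (x ^ 2)" for x
    using char_poly_adjacency_matrix_bipartite[of G us ws x] bip us ws
    by (simp add: p_def c_def m_def n_def)
  have q: "x ^ n * poly q x = x ^ (k * m) * poly (char_poly (of_nat k \<cdot>\<^sub>m codegree_matrix G V1 ws)) (x ^ 2)" for x
    using char_poly_adjacency_matrix_bipartite[of ?H us' ws' x] bipartite_ktuple_graph[OF bip, of k]
      us' ws' codegree_matrix_ktuple_graph[OF ws(2), of k V1 G]
    by (simp add: q_def n_def len' flip: ws'_def)
  \<comment> \<open>At \<open>s * x\<close> the square is \<open>k * x ^ 2\<close>, where the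
    characteristic polynomial of the scaled codegree matrix reduces to \<open>c\<close>. For
    \<open>x \<noteq> 0\<close> the factor \<open>(s * x) ^ n\<close> cancels.\<close>
  have "poly q (s * x) = s ^ (k * m + n) * x ^ ((k - 1) * m) * poly p x" if x: "x \<noteq> 0" for x
  proof -
    have km: "k * m = (k - 1) * m + m" using k by (cases k) auto
    have "(s * x) ^ n * poly q (s * x) = (s * x) ^ (k * m) * (s ^ 2) ^ n * poly c (x ^ 2)"
      unfolding q power_mult_distrib[of s x 2] s2
        poly_char_poly_smult_mat[OF codegree_matrix_carrier] by (simp add: c_def n_def)
    also have "\<dots> = s ^ (k * m) * x ^ ((k - 1) * m) * (s ^ 2) ^ n * (x ^ m * poly c (x ^ 2))"
      by (simp add: km power_add power_mult_distrib)
    also have "\<dots> = (s * x) ^ n * (s ^ (k * m + n) * x ^ ((k - 1) * m) * poly p x)"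
      unfolding p[symmetric] by (simp add: power_add power_mult_distrib power2_eq_square)
    finally show ?thesis using s0 x by simp
  qed
  moreover have "p \<noteq> 0"
    using degree_monic_char_poly[of "adjacency_matrix G (us @ ws)" "length (us @ ws)"]
    by (auto simp: p_def adjacency_matrix_def)
  ultimately have "proots q = image_mset ((*) s) (proots p) + replicate_mset ((k - 1) * m) 0"
    using s0 by (intro proots_scaled[of s "s ^ (k * m + n)"]) auto
  moreover have "graph_spectrum G = proots p"
    unfolding p_def using us ws V by (intro graph_spectrum_eq) auto
  moreover have "graph_spectrum ?H = proots q"
    unfolding q_def using us' ws' by (intro graph_spectrum_eq) (auto simp: ktuple_graph_def)
  ultimately show ?thesis by (simp add: m s_def)
qed

section \<open>Vertex count and assembly of the three claims\<close>

lemma card_pverts_ktuple_graph: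
  assumes "finite V1" "finite V2"
  shows "card (pverts (ktuple_graph k V1 V2 G)) = k * card V1 + card V2"
  using assms
  by (auto simp: ktuple_graph_def card_image card_cartesian_product intro: card_Un_disjoint[THEN trans])

theorem theorem4p4:
  fixes G :: "'a pair_pre_digraph" and V1 V2 :: "'a set" and k D :: nat
  assumes "k \<ge> 1"
    and "bipartite_graph G V1 V2"
    and "Digraph_Component.connected (with_proj G)"
    and "graph_diameter G = ereal (real D)"
    and "D \<ge> 2"
  shows "card (pverts (ktuple_graph k V1 V2 G)) = k * card V1 + card V2 \<and>
    graph_diameter (ktuple_graph k V1 V2 G) = ereal (real D) \<and>
    graph_spectrum (ktuple_graph k V1 V2 G) =
      image_mset (\<lambda>x. complex_of_real (sqrt (real k)) * x) (graph_spectrum G) +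
      replicate_mset ((k - 1) * card V1) 0"
proof (intro conjI)
  let ?H = "ktuple_graph k V1 V2 G"
  interpret G: pair_graph G using assms(2) by (simp add: bipartite_graph_def)
  interpret H: pair_graph ?H using assms(2) by (rule pair_graph_ktuple_graph)
  have V: "pverts G = V1 \<union> V2" "V1 \<inter> V2 = {}"
    and stable: "\<And>u v. u \<in> V1 \<Longrightarrow> v \<in> V1 \<Longrightarrow> (u, v) \<notin> parcs G"
      "\<And>u v. u \<in> V2 \<Longrightarrow> v \<in> V2 \<Longrightarrow> (u, v) \<notin> parcs G"
    using assms(2) by (auto simp: bipartite_graph_def stable_set_def)
  show "card (pverts ?H) = k * card V1 + card V2"
    using G.pair_finite_verts V by (intro card_pverts_ktuple_graph) auto
  \<comment> \<open>The projection forgets the index of a copy. It is onto because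
    \<open>k \<ge> 1\<close>, and it reflects arcs because neither stable set contains an arc of
    \<open>G\<close>.\<close>
  define \<pi> :: "'a \<times> nat + 'a \<Rightarrow> 'a" where "\<pi> = case_sum fst id"
  have "\<pi> ` pverts ?H = pverts G"
    using assms(1) by (force simp: \<pi>_def ktuple_graph_def V image_Un image_image)
  moreover have "(x, y) \<in> parcs ?H \<longleftrightarrow> (\<pi> x, \<pi> y) \<in> parcs G"
    if "x \<in> pverts ?H" "y \<in> pverts ?H" for x y
    using that stable by (auto simp: \<pi>_def ktuple_graph_def)
  ultimately show "graph_diameter ?H = ereal (real D)"
    using graph_diameter_blow_up[OF G.pair_graph_axioms H.pair_wf_digraph_axioms, of \<pi>] assms(4,5)
    by simp
  show "graph_spectrum ?H =
      image_mset (\<lambda>x. complex_of_real (sqrt (real k)) * x) (graph_spectrum G) +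
      replicate_mset ((k - 1) * card V1) 0"
    using assms(1,2) by (rule graph_spectrum_ktuple_graph)
qed

end
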